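(* Let $\beta\in[0,1/2)$. Then $$\lim_{N\to\infty\vert \beta}\frac{\overline{T}(N,p)}{N p |\log p|}=\frac{1}{(\log 2)^2}.$$
   Context: Probabilistic group testing with two-stage algorithms. Let $N\ge 1$ be an integer and $p\in(0,1)$. A configuration $X=(x_1,\dots,x_N)\in\{0,1\}^N$ is drawn from the Bernoulli product measure $\mu_p(X)=\prod_{i=1}^N p^{x_i}(1-p)^{1-x_i}$; variable $i$ is defective iff $x_i=1$. A first stage with $M\ge1$ tests is given by an $N\times M$ binary connectivity matrix $C_{N,M}=(c_{i,a})$; variable $i$ belongs to pool (test) $a$ iff $c_{i,a}=1$. The outcome of test $a$ is $T_a=0$ if $c_{i,a}x_i=0$ for all $i$, and $T_a=1$ otherwise. Variable $i$ is a sure zero if there is a test $a$ with $c_{i,a}=1$ and $T_a=0$. Variable $i$ is a sure one if $x_i=1$ and there is a test $a$ with $c_{i,a}=1$ such that every $j\neq i$ with $c_{j,a}=1$ is a sure zero. Let $\mathcal U_0$ be the set of $i$ with $x_i=0$ that are not sure zeros and $\mathcal U_1$ the set of $i$ with $x_i=1$ that are not sure ones (these are tested individually in the second stage). Set $T(X,M,C_{N,M}):=M+|\mathcal U_0|+|\mathcal U_1|$, $T_{M,C_{N,M},p}:=\sum_{X\in\{0,1\}^N}\mu_p(X)\,T(X,M,C_{N,M})$, and $\overline T(N,p):=\min_{M\in\{1,\dots,N\}}\min_{C_{N,M}\in\{0,1\}^{N\times M}}T_{M,C_{N,M},p}$. Here $\log$ is the natural logarithm. Limit notation: for $\beta>0$,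 $\lim_{N\to\infty\vert\beta}f(N,p):=\lim_{N\to\infty}f(N,N^{-\beta})$; for $\beta=0$, $\lim_{N\to\infty\vert 0}f(N,p):=\lim_{p\to0}\lim_{N\to\infty}f(N,p)$. *)

theory Defs
  imports Complex_Main "HOL-Library.FuncSet"
begin

(* Variables are indexed 0..<N, tests 0..<M.
   A configuration is x :: nat => nat with x i in {0,1} for i < N (and x i = undefined otherwise).
   A connectivity matrix is c :: nat * nat => nat with c (i,a) in {0,1}. *)

definition configs :: "nat \<Rightarrow> (nat \<Rightarrow> nat) set" where
  "configs N = PiE {0..<N} (\<lambda>_. {0,1})"

definition matrices :: "nat \<Rightarrow> nat \<Rightarrow> (nat \<times> nat \<Rightarrow> nat) set" where
  "matrices N M = PiE ({0..<N} \<times> {0..<M}) (\<lambda>_. {0,1})"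

definition mu :: "real \<Rightarrow> nat \<Rightarrow> (nat \<Rightarrow> nat) \<Rightarrow> real" where
  "mu p N x = (\<Prod>i<N. p ^ (x i) * (1 - p) ^ (1 - x i))"

definition test_outcome :: "nat \<Rightarrow> (nat \<times> nat \<Rightarrow> nat) \<Rightarrow> (nat \<Rightarrow> nat) \<Rightarrow> nat \<Rightarrow> nat" where
  "test_outcome N c x a = (if \<forall>i<N. c (i,a) * x i = 0 then 0 else 1)"

definition sure_zero :: "nat \<Rightarrow> nat \<Rightarrow> (nat \<times> nat \<Rightarrow> nat) \<Rightarrow> (nat \<Rightarrow> nat) \<Rightarrow> nat \<Rightarrow> bool" where
  "sure_zero N M c x i \<longleftrightarrow> (\<exists>a<M. c (i,a) = 1 \<and> test_outcome N c x a = 0)"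

definition sure_one :: "nat \<Rightarrow> nat \<Rightarrow> (nat \<times> nat \<Rightarrow> nat) \<Rightarrow> (nat \<Rightarrow> nat) \<Rightarrow> nat \<Rightarrow> bool" where
  "sure_one N M c x i \<longleftrightarrow> x i = 1 \<and>
     (\<exists>a<M. c (i,a) = 1 \<and> (\<forall>j<N. j \<noteq> i \<and> c (j,a) = 1 \<longrightarrow> sure_zero N M c x j))"

definition U0 :: "nat \<Rightarrow> nat \<Rightarrow> (nat \<times> nat \<Rightarrow> nat) \<Rightarrow> (nat \<Rightarrow> nat) \<Rightarrow> nat set" where
  "U0 N M c x = {i. i < N \<and> x i = 0 \<and> \<not> sure_zero N M c x i}"

definition U1 :: "nat \<Rightarrow> nat \<Rightarrow> (nat \<times> nat \<Rightarrow> nat) \<Rightarrow> (nat \<Rightarrow> nat) \<Rightarrow> nat set" where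
  "U1 N M c x = {i. i < N \<and> x i = 1 \<and> \<not> sure_one N M c x i}"

definition Tcost :: "nat \<Rightarrow> nat \<Rightarrow> (nat \<times> nat \<Rightarrow> nat) \<Rightarrow> (nat \<Rightarrow> nat) \<Rightarrow> real" where
  "Tcost N M c x = real M + real (card (U0 N M c x)) + real (card (U1 N M c x))"

definition Texp :: "nat \<Rightarrow> nat \<Rightarrow> (nat \<times> nat \<Rightarrow> nat) \<Rightarrow> real \<Rightarrow> real" where
  "Texp N M c p = (\<Sum>x\<in>configs N. mu p N x * Tcost N M c x)"

definition Tbar :: "nat \<Rightarrow> real \<Rightarrow> real" where
  "Tbar N p = Min ((\<lambda>(M, c). Texp N M c p) ` {(M, c). M \<in> {1..N} \<and> c \<in> matrices N M})"

definition lim_beta :: "real \<Rightarrow> (nat \<Rightarrow> real \<Rightarrow> real) \<Rightarrow> real \<Rightarrow> bool" where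
  "lim_beta \<beta> f L \<longleftrightarrow>
     (if \<beta> > 0 then ((\<lambda>N. f N (real N powr (- \<beta>))) \<longlongrightarrow> L) sequentially
      else (\<exists>g. (\<forall>\<^sub>F p in at_right 0. ((\<lambda>N. f N p) \<longlongrightarrow> g p) sequentially)
                 \<and> (g \<longlongrightarrow> L) (at_right 0)))"

end

theory Submission
  imports Defs "HOL-Analysis.Convex" "HOL-Real_Asymp.Real_Asymp"
begin

text \<open>
  Since the expected number of defectives \<open>N p\<close> is of smaller order than \<open>N p |log p|\<close>, the set \<open>U1\<close>
  is irrelevant to first order, and only the number of tests and the expected size of \<open>U0\<close> matter.

  Lower bound: by Harris' inequality an item with \<open>x i = 0\<close> is not a sure zero with probability at
  least the product of \<open>1 - (1 - p) ^ (n - 1)\<close> over the sizes \<open>n\<close> of its pools. Write this product as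
  \<open>exp (- s)\<close> and bound it below by a tangent line; the sum of all \<open>s\<close> over the items is a sum over the
  pools, in which a pool of size \<open>n \<ge> 2\<close> contributes at most \<open>- n ln (1 - (1 - p) ^ (n - 1))\<close>, and this
  is at most \<open>((ln 2)\<^sup>2 - p ln p) / p\<close> because \<open>ln u * ln (1 - u) \<le> (ln 2)\<^sup>2\<close>. Pools of size 1 cost one
  test per item, which is more than the bound charges for that item.

  Upper bound: in each of about \<open>log2 (1/p)\<close> rounds, split the items at random into about
  \<open>N p / ln 2\<close> pools. A pool is then positive with probability about \<open>1/2\<close>, independently between
  rounds once the defective set is fixed, so a healthy item stays undetermined with probability about
  \<open>p\<close>. Chebyshev's inequality controls the number of defectives; its error is negligible
  when \<open>|log p| / (N p\<^sup>2)\<close> tends to 0, which is where \<open>\<beta> < 1/2\<close> enters.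

  For \<open>\<beta> = 0\<close> the inner limit exists by Fekete's lemma, as block designs make \<open>Tbar\<close> subadditive.
\<close>

subsection \<open>Bernoulli measure on subsets\<close>

text \<open>The expectation of \<open>f D\<close> for a random \<open>D\<close> containing each
  element of \<open>A\<close> independently with probability \<open>p\<close>. With subsets in place
  of 0/1-vectors, monotonicity is that of inclusion.\<close>

definition bexp :: "real \<Rightarrow> 'a set \<Rightarrow> ('a set \<Rightarrow> real) \<Rightarrow> real" where
  "bexp p A f = (\<Sum>D\<in>Pow A. p ^ card D * (1 - p) ^ card (A - D) * f D)"

lemma bexp_empty [simp]: "bexp p {} f = f {}"
  by (simp add: bexp_def)

lemma bexp_insert:
  assumes "finite A" "i \<notin> A"
  shows "bexp p (insert i A) f = p * bexp p A (\<lambda>D. f (insert i D)) + (1 - p) * bexp p A f"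
proof -
  have inj: "inj_on (insert i) (Pow A)"
    using assms(2) by (auto simp: inj_on_def)
  have disj: "Pow A \<inter> insert i ` Pow A = {}"
    using assms(2) by auto
  have out: "p ^ card D * (1 - p) ^ card (insert i A - D) = (1 - p) * (p ^ card D * (1 - p) ^ card (A - D))"
    if "D \<in> Pow A" for D
  proof -
    have "insert i A - D = insert i (A - D)" using that assms(2) by auto
    then show ?thesis using assms by simp
  qed
  have inn: "p ^ card (insert i D) * (1 - p) ^ card (insert i A - insert i D)
      = p * (p ^ card D * (1 - p) ^ card (A - D))"
    if "D \<in> Pow A" for D
  proof -
    have "insert i A - insert i D = A - D" using that assms(2) by auto
    moreover have "finite D" "i \<notin> D" using that assms finite_subset by auto
    ultimately show ?thesis by simp
  qed
  have "bexp p (insert i A) f = (\<Sum>D\<in>Pow A. p ^ card D * (1 - p) ^ card (insert i A - D) * f D)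
      + (\<Sum>D\<in>Pow A. p ^ card (insert i D) * (1 - p) ^ card (insert i A - insert i D) * f (insert i D))"
    unfolding bexp_def Pow_insert
    by (subst sum.union_disjoint) (use assms disj in \<open>auto simp: sum.reindex[OF inj] o_def\<close>)
  also have "\<dots> = (\<Sum>D\<in>Pow A. (1 - p) * (p ^ card D * (1 - p) ^ card (A - D)) * f D)
      + (\<Sum>D\<in>Pow A. p * (p ^ card D * (1 - p) ^ card (A - D)) * f (insert i D))"
    by (intro arg_cong2[of _ _ _ _ "(+)"] sum.cong refl) (simp_all only: out inn)
  finally show ?thesis
    by (simp add: bexp_def sum_distrib_left mult_ac)
qed

lemma bexp_cong:
  assumes "\<And>D. D \<subseteq> A \<Longrightarrow> f D = g D"
  shows "bexp p A f = bexp p A g"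
  unfolding bexp_def by (intro sum.cong) (use assms in auto)

lemma bexp_mono:
  assumes "0 \<le> p" "p \<le> 1" "\<And>D. D \<subseteq> A \<Longrightarrow> f D \<le> g D"
  shows "bexp p A f \<le> bexp p A g"
  unfolding bexp_def by (intro sum_mono mult_left_mono) (use assms in auto)

lemma bexp_add: "bexp p A (\<lambda>D. f D + g D) = bexp p A f + bexp p A g"
  by (simp add: bexp_def algebra_simps sum.distrib)

lemma bexp_diff: "bexp p A (\<lambda>D. f D - g D) = bexp p A f - bexp p A g"
  by (simp add: bexp_def algebra_simps sum_subtractf)

lemma bexp_cmult: "bexp p A (\<lambda>D. k * f D) = k * bexp p A f"
  by (simp add: bexp_def algebra_simps sum_distrib_left)

lemma bexp_sum: "bexp p A (\<lambda>D. \<Sum>i\<in>I. f i D) = (\<Sum>i\<in>I. bexp p A (f i))"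
  unfolding bexp_def by (simp add: sum_distrib_left) (rule sum.swap)

lemma bexp_const:
  assumes "finite A"
  shows "bexp p A (\<lambda>_. k) = k"
  using assms by induction (auto simp: bexp_insert algebra_simps)

lemma bexp_nonneg:
  assumes "0 \<le> p" "p \<le> 1" "\<And>D. D \<subseteq> A \<Longrightarrow> 0 \<le> f D"
  shows "0 \<le> bexp p A f"
  unfolding bexp_def by (intro sum_nonneg mult_nonneg_nonneg) (use assms in auto)

lemma bexp_union:
  assumes "finite A" "finite B" "A \<inter> B = {}"
  shows "bexp p (A \<union> B) f = bexp p A (\<lambda>D. bexp p B (\<lambda>E. f (D \<union> E)))"
  using assms
  by (induction A arbitrary: f) (auto simp: bexp_insert)

lemma bexp_image:
  assumes "finite A" "inj_on g A"
  shows "bexp p (g ` A) f = bexp p A (\<lambda>D. f (g ` D))"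
  using assms
  by (induction A arbitrary: f) (auto simp: bexp_insert)

lemma bexp_disjnt:
  assumes "finite A"
  shows "bexp p A (\<lambda>D. of_bool (D \<inter> S = {})) = (1 - p) ^ card (A \<inter> S)"
  using assms
proof induction
  case (insert i A)
  show ?case
  proof (cases "i \<in> S")
    case True
    then show ?thesis using insert
      by (simp add: bexp_insert bexp_const Int_insert_left)
  next
    case False
    then show ?thesis using insert
      by (simp add: bexp_insert Int_insert_left algebra_simps)
  qed
qed simp

text \<open>Variance plus squared bias. The centre \<open>t\<close> is arbitrary because in the
  induction a new element shifts it to \<open>t - 1\<close>.\<close>

lemma bexp_card_square:
  assumes "finite A"
  shows "bexp p A (\<lambda>D. (real (card D) - t)\<^sup>2) = (real (card A) * p - t)\<^sup>2 + real (card A) * p * (1 - p)"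
  using assms
proof (induction A arbitrary: t)
  case (insert i A)
  have "bexp p A (\<lambda>D. (real (card (insert i D)) - t)\<^sup>2) = bexp p A (\<lambda>D. (real (card D) - (t - 1))\<^sup>2)"
  proof (rule bexp_cong)
    fix D assume "D \<subseteq> A"
    then have "finite D" "i \<notin> D" using insert finite_subset by auto
    then show "(real (card (insert i D)) - t)\<^sup>2 = (real (card D) - (t - 1))\<^sup>2"
      by (simp add: algebra_simps)
  qed
  then have "bexp p (insert i A) (\<lambda>D. (real (card D) - t)\<^sup>2) =
      p * ((real (card A) * p - (t - 1))\<^sup>2 + real (card A) * p * (1 - p))
      + (1 - p) * ((real (card A) * p - t)\<^sup>2 + real (card A) * p * (1 - p))"
    unfolding bexp_insert[OF insert.hyps] insert.IH by simp
  also have "\<dots> = ((real (card A) + 1) * p - t)\<^sup>2 + (real (card A) + 1) * p * (1 - p)"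
    by algebra
  finally show ?case using insert.hyps by (simp add: add.commute)
qed simp

lemma bexp_card:
  assumes "finite A"
  shows "bexp p A (\<lambda>D. real (card D)) = real (card A) * p"
  using assms
proof (induction A)
  case (insert i A)
  have "bexp p A (\<lambda>D. real (card (insert i D))) = bexp p A (\<lambda>D. 1 + real (card D))"
  proof (rule bexp_cong)
    fix D assume "D \<subseteq> A"
    then have "finite D" "i \<notin> D" using insert finite_subset by auto
    then show "real (card (insert i D)) = 1 + real (card D)" by simp
  qed
  then show ?case using insert
    by (simp add: bexp_insert bexp_add bexp_const algebra_simps)
qed simp

text \<open>Markov's inequality for the squared deviation; it is the upper tail that matters, as too
  many defectives make too many pools positive.\<close>

lemma bexp_chebyshev:
  assumes "0 \<le> p" "p \<le> 1" "finite A" "0 < t"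
  shows "bexp p A (\<lambda>D. of_bool (real (card A) * p + t < real (card D))) \<le> real (card A) * p / t\<^sup>2"
proof -
  let ?n = "real (card A) * p"
  have "t\<^sup>2 * bexp p A (\<lambda>D. of_bool (?n + t < real (card D))) = bexp p A (\<lambda>D. t\<^sup>2 * of_bool (?n + t < real (card D)))"
    by (simp add: bexp_cmult)
  also have "\<dots> \<le> bexp p A (\<lambda>D. (real (card D) - ?n)\<^sup>2)"
  proof (intro bexp_mono assms)
    fix D
    show "t\<^sup>2 * of_bool (?n + t < real (card D)) \<le> (real (card D) - ?n)\<^sup>2"
      using assms(4) by (auto intro!: power_mono)
  qed
  also have "\<dots> = ?n * (1 - p)" using assms(3) by (simp add: bexp_card_square)
  also have "\<dots> \<le> ?n" using assms by (simp add: mult_left_le)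
  finally show ?thesis using assms(4) by (simp add: field_simps)
qed

text \<open>Conditioning on \<open>i\<close> splits the covariance into the average of two
  conditional covariances plus \<open>p * (1 - p)\<close> times the product of the increments of
  both means; monotonicity makes these increments nonnegative.\<close>

lemma harris_inequality:
  assumes "0 \<le> p" "p \<le> 1" "finite A" "mono f" "mono g"
  shows "bexp p A f * bexp p A g \<le> bexp p A (\<lambda>D. f D * g D)"
  using assms(3-5)
proof (induction A arbitrary: f g)
  case (insert i A)
  let ?f = "\<lambda>D. f (insert i D)" and ?g = "\<lambda>D. g (insert i D)"
  have mono: "mono ?f" "mono ?g"
    by (intro monoI insert_mono monoD[OF insert.prems(1)] monoD[OF insert.prems(2)]; assumption)+
  have f: "bexp p A f \<le> bexp p A ?f" and g: "bexp p A g \<le> bexp p A ?g"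
    using insert.prems by (auto intro!: bexp_mono assms simp: mono_def subset_insertI)
  have "bexp p (insert i A) (\<lambda>D. f D * g D) - bexp p (insert i A) f * bexp p (insert i A) g
      = p * (bexp p A (\<lambda>D. ?f D * ?g D) - bexp p A ?f * bexp p A ?g)
      + (1 - p) * (bexp p A (\<lambda>D. f D * g D) - bexp p A f * bexp p A g)
      + p * (1 - p) * ((bexp p A ?f - bexp p A f) * (bexp p A ?g - bexp p A g))"
    using insert.hyps by (simp add: bexp_insert algebra_simps)
  moreover have "\<dots> \<ge> 0"
    using insert.IH[OF mono] insert.IH[OF insert.prems] f g assms
    by (intro add_nonneg_nonneg mult_nonneg_nonneg) auto
  ultimately show ?case by linarith
qed simp

lemma harris_inequality_prod:
  assumes "0 \<le> p" "p \<le> 1" "finite A" "finite I"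
    and "\<And>a. a \<in> I \<Longrightarrow> mono (f a)" "\<And>a D. a \<in> I \<Longrightarrow> 0 \<le> f a D"
  shows "(\<Prod>a\<in>I. bexp p A (f a)) \<le> bexp p A (\<lambda>D. \<Prod>a\<in>I. f a D)"
  using assms(4-6)
proof (induction I)
  case empty
  then show ?case using assms by (simp add: bexp_const)
next
  case (insert b I)
  have mono: "mono (\<lambda>D. \<Prod>a\<in>I. f a D)"
    using insert.prems by (auto simp: mono_def intro!: prod_mono)
  have "(\<Prod>a\<in>insert b I. bexp p A (f a)) = bexp p A (f b) * (\<Prod>a\<in>I. bexp p A (f a))"
    using insert by simp
  also have "\<dots> \<le> bexp p A (f b) * bexp p A (\<lambda>D. \<Prod>a\<in>I. f a D)"
    using insert.IH insert.prems by (intro mult_left_mono bexp_nonneg) (auto intro: assms)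
  also have "\<dots> \<le> bexp p A (\<lambda>D. f b D * (\<Prod>a\<in>I. f a D))"
    using insert.prems mono by (intro harris_inequality assms(1-3)) auto
  finally show ?case using insert by simp
qed

section \<open>Configurations as sets of defective items\<close>

definition chi :: "'a set \<Rightarrow> 'a \<Rightarrow> nat" where
  "chi D i = of_bool (i \<in> D)"

lemma Tcost_cong:
  assumes "\<And>i. i < N \<Longrightarrow> x i = y i"
  shows "Tcost N M c x = Tcost N M c y"
proof -
  have T: "test_outcome N c x = test_outcome N c y"
    using assms by (auto simp: test_outcome_def fun_eq_iff)
  have S: "sure_zero N M c x = sure_zero N M c y"
    by (simp add: sure_zero_def fun_eq_iff T)
  have "U0 N M c x = U0 N M c y"
    using assms by (auto simp: U0_def S)
  moreover have "U1 N M c x = U1 N M c y"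
    using assms by (auto simp: U1_def sure_one_def S)
  ultimately show ?thesis by (simp add: Tcost_def)
qed

text \<open>A configuration corresponds to its set of ones, and \<open>mu\<close> becomes the weight
  in \<open>bexp\<close>. Outside \<open>{..<N}\<close> the function \<open>chi D\<close> may differ
  from the extensional configuration; \<open>Tcost_cong\<close> absorbs this.\<close>

lemma Texp_eq_bexp: "Texp N M c p = bexp p {..<N} (\<lambda>D. Tcost N M c (chi D))"
  unfolding Texp_def bexp_def
proof (rule sum.reindex_bij_witness[where i = "\<lambda>D. restrict (chi D) {0..<N}" and j = "\<lambda>x. {i. i < N \<and> x i = 1}"], goal_cases)
  case (1 x)
  then show ?case
    by (fastforce simp: configs_def chi_def fun_eq_iff PiE_def Pi_def extensional_def)
next
  case (5 x)
  then have x: "x i \<in> {0, 1}" if "i < N" for i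
    using that by (auto simp: configs_def)
  let ?D = "{i. i < N \<and> x i = 1}"
  have "mu p N x = (\<Prod>i<N. if i \<in> ?D then p else 1 - p)"
    unfolding mu_def using x by (intro prod.cong) force+
  also have "\<dots> = p ^ card ?D * (1 - p) ^ card ({..<N} - ?D)"
    by (subst prod.If_cases) (auto intro!: arg_cong2[of _ _ _ _ "(*)"] arg_cong[of _ _ card] arg_cong2[of _ _ _ _ "(^)"])
  finally have "mu p N x = p ^ card ?D * (1 - p) ^ card ({..<N} - ?D)" .
  moreover have "Tcost N M c (chi ?D) = Tcost N M c x"
    using x by (intro Tcost_cong) (force simp: chi_def)
  ultimately show ?case by simp
qed (auto simp: configs_def chi_def)

subsection \<open>Lower bound\<close>

text \<open>The left side is symmetric under exchanging \<open>u\<close> and \<open>1 - u\<close>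
  and increases up to \<open>u = 1/2\<close>. The extremal case is a pool that is positive with
  probability one half, whence the constant.\<close>

lemma ln_mult_ln_one_minus_le:
  fixes u :: real
  assumes "0 < u" "u < 1"
  shows "ln u * ln (1 - u) \<le> (ln 2)\<^sup>2"
proof -
  have half: "ln u * ln (1 - u) \<le> (ln 2)\<^sup>2" if u: "0 < u" "u \<le> 1/2" for u :: real
  proof -
    have "ln u * ln (1 - u) \<le> ln (1/2) * ln (1 - 1/2 :: real)"
    proof (rule DERIV_nonneg_imp_nondecreasing[OF u(2)], goal_cases)
      case (1 x)
      then have x: "0 < x" "x \<le> 1/2" using u by auto
      \<comment> \<open>Concavity of the logarithm on the segment from \<open>1\<close> to \<open>x\<close>, which contains \<open>1 - x\<close>.\<close>
      define t where "t = x / (1 - x)"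
      have t: "0 \<le> t" "t \<le> 1" "t * (1 - x) = x" using x by (auto simp: t_def)
      have "1 - x = (1 - t) * 1 + t * x" using t(3) by (simp add: algebra_simps)
      moreover have "(1 - t) * ln 1 + t * ln x \<le> ln ((1 - t) *\<^sub>R 1 + t *\<^sub>R x)"
        using concave_onD[OF ln_concave, of t 1 x] t x by auto
      ultimately have "t * ln x \<le> ln (1 - x)" by (simp only: ln_one real_scaleR_def)
      then have "x * ln x \<le> (1 - x) * ln (1 - x)"
        using x by (simp add: t_def field_simps)
      then have "0 \<le> ln (1 - x) / x - ln x / (1 - x)"
        using x by (simp add: field_simps)
      moreover have "((\<lambda>x. ln x * ln (1 - x)) has_real_derivative ln (1 - x) / x - ln x / (1 - x)) (at x)"
        using x by (auto intro!: derivative_eq_intros simp: field_simps)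
      ultimately show ?case by blast
    qed
    then show ?thesis by (simp add: ln_div power2_eq_square)
  qed
  show ?thesis
    using half[of u] half[of "1 - u"] assms by (cases "u \<le> 1/2") (auto simp: mult.commute)
qed

section \<open>Pools and the items they leave undetermined\<close>

definition pool :: "nat \<Rightarrow> (nat \<times> nat \<Rightarrow> nat) \<Rightarrow> nat \<Rightarrow> nat set" where
  "pool N c a = {i. i < N \<and> c (i, a) = 1}"

lemma finite_pool [simp]: "finite (pool N c a)"
  by (simp add: pool_def)

lemma matrices_values:
  assumes "c \<in> matrices N M" "i < N" "a < M"
  shows "c (i, a) = 0 \<or> c (i, a) = 1"
  using assms by (auto simp: matrices_def PiE_def Pi_def)

lemma sure_zero_chi_iff:
  assumes "c \<in> matrices N M" "D \<subseteq> {..<N}" "i < N"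
  shows "sure_zero N M c (chi D) i \<longleftrightarrow> (\<exists>a<M. i \<in> pool N c a \<and> D \<inter> pool N c a = {})"
proof -
  have "test_outcome N c (chi D) a = 0 \<longleftrightarrow> D \<inter> pool N c a = {}" if "a < M" for a
  proof -
    have "c (j, a) * chi D j = 0 \<longleftrightarrow> j \<notin> D \<inter> pool N c a" if "j < N" for j
      using matrices_values[OF assms(1) that \<open>a < M\<close>] that by (auto simp: pool_def chi_def)
    then have "test_outcome N c (chi D) a = 0 \<longleftrightarrow> (\<forall>j<N. j \<notin> D \<inter> pool N c a)"
      by (simp add: test_outcome_def)
    then show ?thesis using assms(2) by auto
  qed
  then show ?thesis using assms(3) by (auto simp: sure_zero_def pool_def)
qed

lemma U0_chi:
  assumes "c \<in> matrices N M" "D \<subseteq> {..<N}"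
  shows "U0 N M c (chi D) = {i. i < N \<and> i \<notin> D \<and> (\<forall>a<M. i \<in> pool N c a \<longrightarrow> D \<inter> pool N c a \<noteq> {})}"
  using sure_zero_chi_iff[OF assms] by (auto simp: U0_def chi_def)

text \<open>Here \<open>v\<close> is the probability that \<open>n - 1\<close> given items are
  healthy, and \<open>(n - 1) * p \<le> - ln v\<close>. So \<open>n - 1\<close> of the
  \<open>n\<close> copies of \<open>- ln (1 - v)\<close> are covered by the bound on
  \<open>ln v * ln (1 - v)\<close>.\<close>

lemma pool_information_bound:
  fixes p :: real
  assumes p: "0 < p" "p < 1" and n: "2 \<le> n"
  shows "real n * - ln (1 - (1 - p) ^ (n - 1)) \<le> ((ln 2)\<^sup>2 - p * ln p) / p"
proof -
  define v where "v = (1 - p) ^ (n - 1)"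
  have "v \<le> (1 - p) ^ 1"
    unfolding v_def by (rule power_decreasing) (use p n in auto)
  then have v: "0 < v" "v \<le> 1 - p" using p by (auto simp: v_def)
  have lnv: "real (n - 1) * p \<le> - ln v"
  proof -
    have "ln (1 - p) \<le> - p" using ln_le_minus_one[of "1 - p"] p by simp
    then have "real (n - 1) * ln (1 - p) \<le> real (n - 1) * - p" by (intro mult_left_mono) auto
    moreover have "ln v = real (n - 1) * ln (1 - p)" using p by (simp add: v_def ln_realpow)
    ultimately show ?thesis by simp
  qed
  have lnw: "0 \<le> - ln (1 - v)" "- ln (1 - v) \<le> - ln p" using v p by auto
  have "real (n - 1) = real n - 1" using n by simp
  \<comment> \<open>The remaining copy is at most \<open>- ln p\<close>, since
    \<open>n \<ge> 2\<close> forces \<open>1 - v \<ge> p\<close>; it yields the correction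
    \<open>- p * ln p\<close>.\<close>
  then have "p * (real n * - ln (1 - v)) = real (n - 1) * p * - ln (1 - v) + p * - ln (1 - v)"
    by (simp add: algebra_simps)
  also have "\<dots> \<le> - ln v * - ln (1 - v) + p * - ln p"
    using lnv lnw p by (intro add_mono[OF mult_right_mono mult_left_mono]) auto
  also have "\<dots> \<le> (ln 2)\<^sup>2 - p * ln p"
    using ln_mult_ln_one_minus_le[of v] v p by simp
  finally show ?thesis
    unfolding v_def[symmetric] pos_le_divide_eq[OF p(1)] by (simp only: mult.commute)
qed

text \<open>A healthy \<open>i\<close> is undetermined iff each of its pools contains a defective
  other than \<open>i\<close>. These events are increasing in the defective set, so Harris'
  inequality applies; the exponents count the pool members besides \<open>i\<close>.\<close>

lemma prob_U0_ge:
  assumes p: "0 \<le> p" "p \<le> 1" and c: "c \<in> matrices N M" and i: "i < N"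
  shows "(1 - p) * (\<Prod>a | a < M \<and> i \<in> pool N c a. 1 - (1 - p) ^ (card (pool N c a) - 1))
    \<le> bexp p {..<N} (\<lambda>D. of_bool (i \<in> U0 N M c (chi D)))"
proof -
  define A where "A = {..<N} - {i}"
  define I where "I = {a. a < M \<and> i \<in> pool N c a}"
  have A: "finite A" "i \<notin> A" "insert i A = {..<N}" and I: "finite I"
    using i by (auto simp: A_def I_def)
  have "bexp p {..<N} (\<lambda>D. of_bool (i \<in> U0 N M c (chi D)))
      = p * bexp p A (\<lambda>D. of_bool (i \<in> U0 N M c (chi (insert i D))))
      + (1 - p) * bexp p A (\<lambda>D. of_bool (i \<in> U0 N M c (chi D)))"
    unfolding A(3)[symmetric] by (rule bexp_insert[OF A(1,2)])
  \<comment> \<open>A defective \<open>i\<close> never lies in \<open>U0\<close>; only the branch of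
    weight \<open>1 - p\<close> survives.\<close>
  also have "bexp p A (\<lambda>D. of_bool (i \<in> U0 N M c (chi (insert i D)))) = bexp p A (\<lambda>_. 0)"
    by (intro bexp_cong) (auto simp: U0_def chi_def)
  also have "bexp p A (\<lambda>D. of_bool (i \<in> U0 N M c (chi D)))
      = bexp p A (\<lambda>D. \<Prod>a\<in>I. of_bool (D \<inter> pool N c a \<noteq> {}))"
  proof (rule bexp_cong)
    fix D assume "D \<subseteq> A"
    then have D: "D \<subseteq> {..<N}" "i \<notin> D" by (auto simp: A_def)
    show "of_bool (i \<in> U0 N M c (chi D)) = (\<Prod>a\<in>I. of_bool (D \<inter> pool N c a \<noteq> {}) :: real)"
      using D(2) i I by (auto simp: U0_chi[OF c D(1)] I_def)
  qed
  finally have E: "bexp p {..<N} (\<lambda>D. of_bool (i \<in> U0 N M c (chi D)))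
      = (1 - p) * bexp p A (\<lambda>D. \<Prod>a\<in>I. of_bool (D \<inter> pool N c a \<noteq> {}))"
    using A by (simp add: bexp_const)
  have "(\<Prod>a\<in>I. 1 - (1 - p) ^ (card (pool N c a) - 1))
      = (\<Prod>a\<in>I. bexp p A (\<lambda>D. of_bool (D \<inter> pool N c a \<noteq> {})))"
  proof (rule prod.cong[OF refl])
    fix a assume "a \<in> I"
    then have "A \<inter> pool N c a = pool N c a - {i}" "i \<in> pool N c a"
      by (auto simp: A_def I_def pool_def)
    then have "card (A \<inter> pool N c a) = card (pool N c a) - 1" by simp
    moreover have "bexp p A (\<lambda>D. of_bool (D \<inter> pool N c a \<noteq> {}))
        = bexp p A (\<lambda>D. 1 - of_bool (D \<inter> pool N c a = {}))"
      by (intro bexp_cong) auto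
    ultimately show "1 - (1 - p) ^ (card (pool N c a) - 1) = bexp p A (\<lambda>D. of_bool (D \<inter> pool N c a \<noteq> {}))"
      using A by (simp add: bexp_diff bexp_const bexp_disjnt)
  qed
  also have "\<dots> \<le> bexp p A (\<lambda>D. \<Prod>a\<in>I. of_bool (D \<inter> pool N c a \<noteq> {}))"
    by (intro harris_inequality_prod p A I) (auto simp: mono_def)
  finally show ?thesis
    using p E by (simp add: I_def mult_left_mono)
qed

text \<open>By convexity \<open>r * exp (- s)\<close> lies above its tangent of slope
  \<open>- B\<close>, which touches it at \<open>s = ln (r / B)\<close>.\<close>

lemma tangent_exp:
  fixes r B s :: real
  assumes "0 < r" "0 < B"
  shows "B * (1 + ln (r / B) - s) \<le> r * exp (- s)"
proof -
  have "B * (1 + (ln (r / B) - s)) \<le> B * exp (ln (r / B) - s)"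
    using assms by (intro mult_left_mono exp_ge_add_one_self) auto
  also have "\<dots> = r * exp (- s)" using assms by (simp add: exp_diff exp_minus field_simps)
  finally show ?thesis by (simp add: algebra_simps)
qed

text \<open>A pricing argument: a pool of size at least 2 contributes at most \<open>1 / B\<close>
  to the sum of all exponents, so its test pays a price of \<open>B\<close> per unit of exponent.
  The tangent of slope \<open>- B\<close> then leaves the value \<open>V\<close> for each
  item.\<close>

lemma Texp_ge:
  assumes p: "0 < p" "p < 1" and c: "c \<in> matrices N M"
  defines "B \<equiv> p / ((ln 2)\<^sup>2 - p * ln p)"
  shows "real N * (B * (1 + ln ((1 - p) / B))) \<le> Texp N M c p"
proof -
  let ?S = "pool N c"
  let ?w = "\<lambda>a. - ln (1 - (1 - p) ^ (card (?S a) - 1))"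
  \<comment> \<open>For a singleton pool the factor is \<open>1 - 1 = 0\<close> and has no usable
    logarithm, so these pools are treated apart. Empty pools enter neither \<open>Q1\<close> nor
    \<open>Q\<close>.\<close>
  define Q1 where "Q1 = {a. a < M \<and> card (?S a) = 1}"
  define Q where "Q = {a. a < M \<and> 2 \<le> card (?S a)}"
  define R where "R = {i. i < N \<and> (\<forall>a<M. i \<in> ?S a \<longrightarrow> card (?S a) \<noteq> 1)}"
  define V where "V = B * (1 + ln ((1 - p) / B))"
  have "p * ln p \<le> 0" using p by (intro mult_nonneg_nonpos) auto
  moreover have "0 < (ln 2 :: real)\<^sup>2" by simp
  ultimately have "0 < (ln 2)\<^sup>2 - p * ln p" by linarith
  then have B: "0 < B" using p by (simp add: B_def)
  \<comment> \<open>The tangent bound at \<open>s = 0\<close>: one test can pay for one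
    item.\<close>
  have V: "V \<le> 1"
    using tangent_exp[of "1 - p" B 0] p B by (simp add: V_def)
  have fin: "finite Q1" "finite Q" "finite R" by (auto simp: Q1_def Q_def R_def)
  have pos: "0 < 1 - (1 - p) ^ (card (?S a) - 1)" "1 - (1 - p) ^ (card (?S a) - 1) \<le> 1" if "a \<in> Q" for a
    using p that by (auto simp: Q_def power_less_one_iff)
  have wpos: "0 \<le> ?w a" if "a \<in> Q" for a
    using pos[OF that] by simp

  have "card Q1 + card Q = card (Q1 \<union> Q)"
    by (rule card_Un_disjoint[symmetric]) (auto simp: Q1_def Q_def)
  also have "\<dots> \<le> card {..<M}"
    by (rule card_mono) (auto simp: Q1_def Q_def)
  finally have M: "card Q1 + card Q \<le> M" by simp
  \<comment> \<open>Each item outside \<open>R\<close> has a singleton pool of its own.\<close>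
  have "{..<N} - R \<subseteq> (\<lambda>a. the_elem (?S a)) ` Q1"
  proof
    fix i assume "i \<in> {..<N} - R"
    then obtain a where a: "a < M" "i \<in> ?S a" "card (?S a) = 1" by (auto simp: R_def)
    then have "?S a = {i}" by (metis card_1_singletonE singletonD)
    then show "i \<in> (\<lambda>a. the_elem (?S a)) ` Q1"
      using a by (auto simp: Q1_def intro!: image_eqI[of _ _ a])
  qed
  then have "card ({..<N} - R) \<le> card Q1"
    using fin by (meson card_image_le card_mono finite_imageI le_trans)
  moreover have RN: "R \<subseteq> {..<N}" by (auto simp: R_def)
  ultimately have NR: "real N - real (card R) \<le> real (card Q1)"
    using fin by (simp add: card_Diff_subset)

  have item: "V - B * (\<Sum>a | a \<in> Q \<and> i \<in> ?S a. ?w a) \<le> bexp p {..<N} (\<lambda>D. of_bool (i \<in> U0 N M c (chi D)))"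
    if "i \<in> R" for i
  proof -
    define I where "I = {a. a \<in> Q \<and> i \<in> ?S a}"
    have I: "{a. a < M \<and> i \<in> ?S a} = I" "finite I" "I \<subseteq> Q"
    proof -
      have "2 \<le> card (?S a)" if "a < M" "i \<in> ?S a" for a
      proof -
        have "card (?S a) \<noteq> 0" using that by auto
        moreover have "card (?S a) \<noteq> 1" using that \<open>i \<in> R\<close> by (auto simp: R_def)
        ultimately show ?thesis by linarith
      qed
      then show "{a. a < M \<and> i \<in> ?S a} = I" by (auto simp: I_def Q_def)
    qed (use fin in \<open>auto simp: I_def\<close>)
    have "exp (- (\<Sum>a\<in>I. ?w a)) = (\<Prod>a\<in>I. exp (- ?w a))"
      using I by (simp add: sum_negf exp_sum)
    also have "\<dots> = (\<Prod>a\<in>I. 1 - (1 - p) ^ (card (?S a) - 1))"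
      using pos I by (intro prod.cong) auto
    finally have "B * (1 + ln ((1 - p) / B) - (\<Sum>a\<in>I. ?w a))
        \<le> (1 - p) * (\<Prod>a\<in>I. 1 - (1 - p) ^ (card (?S a) - 1))"
      using tangent_exp[of "1 - p" B "\<Sum>a\<in>I. ?w a"] p B by simp
    also have "\<dots> \<le> bexp p {..<N} (\<lambda>D. of_bool (i \<in> U0 N M c (chi D)))"
      using prob_U0_ge[of p c N M i] p c that by (auto simp: I R_def)
    finally show ?thesis by (simp add: V_def I_def algebra_simps)
  qed

  \<comment> \<open>Double counting: exponents are summed by pools instead of items, a pool of size
    \<open>n\<close> being met at most \<open>n\<close> times.\<close>
  have "(\<Sum>i\<in>R. \<Sum>a | a \<in> Q \<and> i \<in> ?S a. ?w a) = (\<Sum>a\<in>Q. \<Sum>i | i \<in> R \<and> i \<in> ?S a. ?w a)"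
    by (rule sum.swap_restrict) (use fin in auto)
  also have "\<dots> \<le> (\<Sum>a\<in>Q. 1 / B)"
  proof (rule sum_mono)
    fix a assume a: "a \<in> Q"
    have "card {i. i \<in> R \<and> i \<in> ?S a} \<le> card (?S a)"
      by (rule card_mono) auto
    then have "(\<Sum>i | i \<in> R \<and> i \<in> ?S a. ?w a) \<le> real (card (?S a)) * ?w a"
      using wpos[OF a] by (simp add: mult_right_mono del: mult_minus_right)
    also have "\<dots> \<le> 1 / B"
      using pool_information_bound[of p "card (?S a)"] p a by (simp add: B_def Q_def)
    finally show "(\<Sum>i | i \<in> R \<and> i \<in> ?S a. ?w a) \<le> 1 / B" .
  qed
  finally have W: "B * (\<Sum>i\<in>R. \<Sum>a | a \<in> Q \<and> i \<in> ?S a. ?w a) \<le> real (card Q)"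
    using B by (simp add: field_simps)

  \<comment> \<open>Items outside \<open>R\<close> are charged 1 instead of \<open>V\<close>, paid
    for by the tests in \<open>Q1\<close>; the tests in \<open>Q\<close> pay for the
    exponents.\<close>
  have "real N * V \<le> real (card R) * V + (real N - real (card R))"
  proof -
    have "card R \<le> N" using RN card_mono[of "{..<N}" R] by simp
    then have "(real N - real (card R)) * V \<le> (real N - real (card R)) * 1"
      using V by (intro mult_left_mono) auto
    then show ?thesis by (simp add: algebra_simps)
  qed
  also have "\<dots> \<le> real M + (real (card R) * V - B * (\<Sum>i\<in>R. \<Sum>a | a \<in> Q \<and> i \<in> ?S a. ?w a))"
    using NR M W by linarith
  also have "real (card R) * V - B * (\<Sum>i\<in>R. \<Sum>a | a \<in> Q \<and> i \<in> ?S a. ?w a)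
      = (\<Sum>i\<in>R. V - B * (\<Sum>a | a \<in> Q \<and> i \<in> ?S a. ?w a))"
    by (simp add: sum_subtractf sum_distrib_left)
  also have "\<dots> \<le> (\<Sum>i\<in>R. bexp p {..<N} (\<lambda>D. of_bool (i \<in> U0 N M c (chi D))))"
    by (intro sum_mono item)
  also have "\<dots> = bexp p {..<N} (\<lambda>D. \<Sum>i\<in>R. of_bool (i \<in> U0 N M c (chi D)))"
    by (simp add: bexp_sum)
  also have "real M + \<dots> = bexp p {..<N} (\<lambda>D. real M + (\<Sum>i\<in>R. of_bool (i \<in> U0 N M c (chi D))))"
    by (simp add: bexp_add bexp_const)
  also have "\<dots> \<le> bexp p {..<N} (\<lambda>D. Tcost N M c (chi D))"
  proof (rule bexp_mono)
    fix D
    have "(\<Sum>i\<in>R. of_bool (i \<in> U0 N M c (chi D))) = real (card (R \<inter> U0 N M c (chi D)))"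
      using fin by (simp add: sum.If_cases of_bool_def Int_def)
    also have "\<dots> \<le> real (card (U0 N M c (chi D)))"
      by (auto simp: U0_def intro!: card_mono)
    finally show "real M + (\<Sum>i\<in>R. of_bool (i \<in> U0 N M c (chi D))) \<le> Tcost N M c (chi D)"
      by (simp add: Tcost_def)
  qed (use p in auto)
  finally show ?thesis by (simp add: V_def Texp_eq_bexp)
qed

section \<open>The minimum over admissible designs\<close>

lemma finite_designs: "finite {(M, c). M \<in> {1..N} \<and> c \<in> matrices N M}"
proof -
  have "{(M, c). M \<in> {1..N} \<and> c \<in> matrices N M} = Sigma {1..N} (matrices N)" by auto
  then show ?thesis by (simp add: matrices_def finite_PiE)
qed

lemma Tbar_le:
  assumes "1 \<le> M" "M \<le> N" "c \<in> matrices N M"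
  shows "Tbar N p \<le> Texp N M c p"
  unfolding Tbar_def using assms finite_designs[of N] by (intro Min_le) auto

lemma Tbar_attained:
  assumes "1 \<le> N"
  obtains M c where "1 \<le> M" "M \<le> N" "c \<in> matrices N M" "Tbar N p = Texp N M c p"
proof -
  \<comment> \<open>The zero matrix with one test shows that the minimum is over a nonempty
    set.\<close>
  have "(1, restrict (\<lambda>_. 0) ({0..<N} \<times> {0..<1})) \<in> {(M, c). M \<in> {1..N} \<and> c \<in> matrices N M}"
    using assms by (auto simp: matrices_def)
  then have "Tbar N p \<in> (\<lambda>(M, c). Texp N M c p) ` {(M, c). M \<in> {1..N} \<and> c \<in> matrices N M}"
    unfolding Tbar_def by (intro Min_in finite_imageI finite_designs) blast
  then show thesis using that by auto
qed

lemma Tbar_ge: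
  assumes "0 < p" "p < 1" "1 \<le> N"
  defines "B \<equiv> p / ((ln 2)\<^sup>2 - p * ln p)"
  shows "real N * (B * (1 + ln ((1 - p) / B))) \<le> Tbar N p"
  using Texp_ge[OF assms(1,2)] Tbar_attained[OF assms(3), of p] unfolding B_def by metis

subsection \<open>Subadditivity\<close>

lemma ex_less_add_iff: "(\<exists>a<m + n. P a) \<longleftrightarrow> (\<exists>a<m. P a) \<or> (\<exists>a<n. P (m + a))" for m n :: nat
  by (metis add_less_cancel_left le_add1 le_add_diff_inverse not_le order_less_le_trans)

lemma all_less_add_iff: "(\<forall>a<m + n. P a) \<longleftrightarrow> (\<forall>a<m. P a) \<and> (\<forall>a<n. P (m + a))" for m n :: nat
  using ex_less_add_iff[of m n "\<lambda>a. \<not> P a"] by blast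

lemma card_less_add:
  "card {i. i < m + n \<and> P i} = card {i. i < m \<and> P i} + card {i. i < n \<and> P (m + i)}" for m n :: nat
proof -
  have "{i. i < m + n \<and> P i} = {i. i < m \<and> P i} \<union> (+) m ` {i. i < n \<and> P (m + i)}"
    by (auto simp: image_iff) (metis add_less_cancel_left le_add_diff_inverse not_le)
  moreover have "card ({i. i < m \<and> P i} \<union> (+) m ` {i. i < n \<and> P (m + i)})
      = card {i. i < m \<and> P i} + card ((+) m ` {i. i < n \<and> P (m + i)})"
    by (rule card_Un_disjoint) auto
  ultimately show ?thesis by (simp add: card_image)
qed

definition block_design ::
  "nat \<Rightarrow> nat \<Rightarrow> (nat \<times> nat \<Rightarrow> nat) \<Rightarrow> nat \<Rightarrow> nat \<Rightarrow> (nat \<times> nat \<Rightarrow> nat) \<Rightarrow> nat \<times> nat \<Rightarrow> nat" where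
  "block_design N M c N' M' c' = restrict
    (\<lambda>(i, a). if i < N \<and> a < M then c (i, a) else if N \<le> i \<and> M \<le> a then c' (i - N, a - M) else 0)
    ({0..<N + N'} \<times> {0..<M + M'})"

lemma block_design_in_matrices:
  assumes "c \<in> matrices N M" "c' \<in> matrices N' M'"
  shows "block_design N M c N' M' c' \<in> matrices (N + N') (M + M')"
proof -
  let ?b = "\<lambda>(i, a). if i < N \<and> a < M then c (i, a) else if N \<le> i \<and> M \<le> a then c' (i - N, a - M) else 0"
  have b: "?b (i, a) \<in> {0, 1}" if "i < N + N'" "a < M + M'" for i a
    using matrices_values[OF assms(1), of i a] matrices_values[OF assms(2), of "i - N" "a - M"] that
    by (cases "N \<le> i"; cases "M \<le> a") auto
  have "\<forall>y\<in>{0..<N + N'} \<times> {0..<M + M'}. ?b y \<in> {0, 1}"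
  proof
    fix y assume "y \<in> {0..<N + N'} \<times> {0..<M + M'}"
    then obtain i a where "y = (i, a)" "i < N + N'" "a < M + M'" by auto
    then show "?b y \<in> {0, 1}" using b[of i a] by simp
  qed
  then show ?thesis
    unfolding matrices_def block_design_def restrict_PiE_iff .
qed

text \<open>The off-diagonal entries vanish, so no test mixes the two groups and every decision is
  made within a block.\<close>

lemma Tcost_block_design:
  "Tcost (N + N') (M + M') (block_design N M c N' M' c') x = Tcost N M c x + Tcost N' M' c' (\<lambda>i. x (N + i))"
proof -
  let ?c = "block_design N M c N' M' c'" and ?x = "\<lambda>i. x (N + i)"
  have [simp]: "i < N \<Longrightarrow> a < M \<Longrightarrow> ?c (i, a) = c (i, a)"
    "i < N \<Longrightarrow> a < M' \<Longrightarrow> ?c (i, M + a) = 0"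
    "i < N' \<Longrightarrow> a < M \<Longrightarrow> ?c (N + i, a) = 0"
    "i < N' \<Longrightarrow> a < M' \<Longrightarrow> ?c (N + i, M + a) = c' (i, a)" for i a
    by (auto simp: block_design_def)
  have [simp]: "test_outcome (N + N') ?c x a = test_outcome N c x a" if "a < M" for a
    using that by (simp add: test_outcome_def all_less_add_iff)
  have [simp]: "test_outcome (N + N') ?c x (M + a) = test_outcome N' c' ?x a" if "a < M'" for a
    using that by (simp add: test_outcome_def all_less_add_iff)
  have [simp]: "sure_zero (N + N') (M + M') ?c x i \<longleftrightarrow> sure_zero N M c x i" if "i < N" for i
    using that by (simp add: sure_zero_def ex_less_add_iff cong: conj_cong)
  have [simp]: "sure_zero (N + N') (M + M') ?c x (N + i) \<longleftrightarrow> sure_zero N' M' c' ?x i" if "i < N'" for i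
    using that by (simp add: sure_zero_def ex_less_add_iff cong: conj_cong)
  have [simp]: "sure_one (N + N') (M + M') ?c x i \<longleftrightarrow> sure_one N M c x i" if "i < N" for i
    using that by (simp add: sure_one_def ex_less_add_iff all_less_add_iff cong: conj_cong)
  have [simp]: "sure_one (N + N') (M + M') ?c x (N + i) \<longleftrightarrow> sure_one N' M' c' ?x i" if "i < N'" for i
    using that by (simp add: sure_one_def ex_less_add_iff all_less_add_iff cong: conj_cong)
  show ?thesis
    by (simp add: Tcost_def U0_def U1_def card_less_add cong: conj_cong)
qed

lemma Texp_block_design:
  "Texp (N + N') (M + M') (block_design N M c N' M' c') p = Texp N M c p + Texp N' M' c' p"
proof -
  let ?c = "block_design N M c N' M' c'"
  have disj: "{..<N} \<inter> (+) N ` {..<N'} = {}" by auto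
  have "x \<in> {..<N + N'} \<longleftrightarrow> x \<in> {..<N} \<union> (+) N ` {..<N'}" for x
    using ex_less_add_iff[of N N' "\<lambda>a. a = x"] by auto
  then have "{..<N + N'} = {..<N} \<union> (+) N ` {..<N'}" by blast
  then have "Texp (N + N') (M + M') ?c p
      = bexp p {..<N} (\<lambda>D. bexp p {..<N'} (\<lambda>E. Tcost (N + N') (M + M') ?c (chi (D \<union> (+) N ` E))))"
    using bexp_union[OF _ _ disj] by (simp add: Texp_eq_bexp bexp_image)
  also have "\<dots> = bexp p {..<N} (\<lambda>D. bexp p {..<N'} (\<lambda>E. Tcost N M c (chi D) + Tcost N' M' c' (chi E)))"
  proof (intro bexp_cong)
    fix D E :: "nat set" assume D: "D \<subseteq> {..<N}"
    have "Tcost N M c (chi (D \<union> (+) N ` E)) = Tcost N M c (chi D)"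
      by (intro Tcost_cong) (auto simp: chi_def)
    moreover have "Tcost N' M' c' (\<lambda>i. chi (D \<union> (+) N ` E) (N + i)) = Tcost N' M' c' (chi E)"
      by (intro Tcost_cong) (use D in \<open>auto simp: chi_def\<close>)
    ultimately show "Tcost (N + N') (M + M') ?c (chi (D \<union> (+) N ` E)) = Tcost N M c (chi D) + Tcost N' M' c' (chi E)"
      by (simp add: Tcost_block_design)
  qed
  finally show ?thesis
    by (simp add: bexp_add bexp_const Texp_eq_bexp)
qed

text \<open>Optimal designs become diagonal blocks, which is admissible since
  \<open>M + M' \<le> N + N'\<close>.\<close>

lemma Tbar_subadditive:
  assumes "1 \<le> N" "1 \<le> N'"
  shows "Tbar (N + N') p \<le> Tbar N p + Tbar N' p"
proof -
  obtain M c where c: "1 \<le> M" "M \<le> N" "c \<in> matrices N M" "Tbar N p = Texp N M c p"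
    using Tbar_attained[OF assms(1)] .
  obtain M' c' where c': "1 \<le> M'" "M' \<le> N'" "c' \<in> matrices N' M'" "Tbar N' p = Texp N' M' c' p"
    using Tbar_attained[OF assms(2)] .
  have "Tbar (N + N') p \<le> Texp (N + N') (M + M') (block_design N M c N' M' c') p"
    using c c' by (intro Tbar_le block_design_in_matrices) auto
  then show ?thesis by (simp add: Texp_block_design c c')
qed

text \<open>The limit is the infimum \<open>g\<close> of the quotients, bounded below by
  nonnegativity. Division with remainder by a near-optimal \<open>k\<close> compares every large
  \<open>n\<close> with \<open>k\<close>.\<close>

lemma fekete_convergent:
  fixes a :: "nat \<Rightarrow> real"
  assumes sub: "\<And>m n. a (m + n) \<le> a m + a n" and nonneg: "\<And>n. 0 \<le> a n"
  shows "convergent (\<lambda>n. a n / real n)"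
proof -
  define g where "g = (INF k\<in>{1..}. a k / real k)"
  have bdd: "bdd_below ((\<lambda>k. a k / real k) ` {1..})"
    using nonneg by (intro bdd_belowI2[of _ 0]) auto
  have mult: "a (q * k) \<le> real q * a k" if "1 \<le> q" for q k
    using that
  proof (induction q rule: dec_induct)
    case (step q)
    then show ?case using sub[of k "q * k"] by (simp add: algebra_simps)
  qed simp
  have "(\<lambda>n. a n / real n) \<longlonglongrightarrow> g"
  proof (rule LIMSEQ_I)
    fix e :: real assume "0 < e"
    then obtain k where k: "1 \<le> k" "a k / real k < g + e / 2"
      using cInf_lessD[of "(\<lambda>k. a k / real k) ` {1..}" "g + e / 2"] by (auto simp: g_def)
    \<comment> \<open>A common bound for the terms at all remainders, including 0; it becomes
      negligible after division by \<open>n\<close>.\<close>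
    define C where "C = (\<Sum>r<k. a r)"
    have C: "a r \<le> C" if "r < k" for r
      unfolding C_def using that nonneg by (intro member_le_sum) auto
    obtain n0 where n0: "2 * C / e < real n0" using reals_Archimedean2 by blast
    have "norm (a n / real n - g) < e" if n: "max k n0 \<le> n" for n
    proof -
      let ?q = "n div k" and ?r = "n mod k"
      have pos: "0 < real n" "1 \<le> ?q" using n k by (auto simp: div_greater_zero_iff Suc_le_eq)
      have "a n = a (?q * k + ?r)" by simp
      also have "\<dots> \<le> real ?q * a k + C"
        using sub[of "?q * k" ?r] mult[OF pos(2), of k] C[of ?r] k by force
      also have "real ?q * a k \<le> real n * (a k / real k)"
      proof -
        have "real ?q * real k \<le> real n" by (metis div_times_less_eq_dividend of_nat_le_iff of_nat_mult)
        then have "real ?q * real k * (a k / real k) \<le> real n * (a k / real k)"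
          using nonneg by (intro mult_right_mono) auto
        then show ?thesis using k by simp
      qed
      finally have "a n / real n \<le> a k / real k + C / real n"
        using pos by (simp add: field_simps)
      moreover have "C / real n < e / 2"
        using n0 n pos \<open>0 < e\<close> by (simp add: field_simps) (meson le_less_trans less_le_trans mult_left_mono of_nat_mono less_imp_le)
      ultimately have "a n / real n < g + e" using k by linarith
      moreover have "g \<le> a n / real n"
        unfolding g_def using pos by (intro cINF_lower bdd) auto
      ultimately show ?thesis using \<open>0 < e\<close> by simp
    qed
    then show "\<exists>no. \<forall>n\<ge>no. norm (a n / real n - g) < e" by blast
  qed
  then show ?thesis by (rule convergentI)
qed

subsection \<open>Upper bound\<close>

text \<open>Test \<open>a\<close> encodes round \<open>a div m\<close> and colour
  \<open>a mod m\<close>, so with colours below \<open>m\<close> every item is in exactly one pool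
  per round.\<close>

definition colouring_design :: "nat \<Rightarrow> nat \<Rightarrow> nat \<Rightarrow> (nat \<Rightarrow> nat \<Rightarrow> nat) \<Rightarrow> nat \<times> nat \<Rightarrow> nat" where
  "colouring_design N L m \<phi> =
    restrict (\<lambda>(i, a). of_bool (\<phi> (a div m) i = a mod m)) ({0..<N} \<times> {0..<L * m})"

lemma colouring_design_in_matrices: "colouring_design N L m \<phi> \<in> matrices N (L * m)"
  by (auto simp: colouring_design_def matrices_def)

lemma U0_colouring_design:
  assumes "\<And>l i. l < L \<Longrightarrow> i < N \<Longrightarrow> \<phi> l i < m" "D \<subseteq> {..<N}"
  shows "U0 N (L * m) (colouring_design N L m \<phi>) (chi D)
    \<subseteq> {i \<in> {..<N} - D. \<forall>l<L. \<exists>j\<in>D. \<phi> l j = \<phi> l i}"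
proof
  fix i assume "i \<in> U0 N (L * m) (colouring_design N L m \<phi>) (chi D)"
  then have i: "i < N" "i \<notin> D"
    and hit: "\<And>a. a < L * m \<Longrightarrow> i \<in> pool N (colouring_design N L m \<phi>) a
      \<Longrightarrow> D \<inter> pool N (colouring_design N L m \<phi>) a \<noteq> {}"
    by (auto simp: U0_chi[OF colouring_design_in_matrices assms(2)])
  have pool: "pool N (colouring_design N L m \<phi>) (l * m + b) = {j. j < N \<and> \<phi> l j = b}"
    if "l < L" "b < m" for l b
  proof -
    have "l * m + b < Suc l * m" using that by simp
    also have "\<dots> \<le> L * m" using that by (intro mult_right_mono) auto
    finally show ?thesis using that by (auto simp: pool_def colouring_design_def)
  qed
  have "\<exists>j\<in>D. \<phi> l j = \<phi> l i" if "l < L" for l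
  proof -
    have b: "\<phi> l i < m" using assms(1) that i by simp
    have "l * m + \<phi> l i < Suc l * m" using b by simp
    also have "\<dots> \<le> L * m" using that by (intro mult_right_mono) auto
    finally show ?thesis using hit[of "l * m + \<phi> l i"] pool[OF that b] i by auto
  qed
  then show "i \<in> {i \<in> {..<N} - D. \<forall>l<L. \<exists>j\<in>D. \<phi> l j = \<phi> l i}" using i by auto
qed

section \<open>Random colourings and their collisions\<close>

abbreviation colourings :: "nat \<Rightarrow> nat \<Rightarrow> (nat \<Rightarrow> nat) set" where
  "colourings N m \<equiv> PiE {..<N} (\<lambda>_. {..<m})"

text \<open>Given the colour of \<open>i\<close>, each element of \<open>D\<close> avoids it in
  \<open>m - 1\<close> of \<open>m\<close> cases, independently; the claim counts the
  complement.\<close>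

lemma card_colliding_colourings:
  assumes "1 \<le> m" "D \<subseteq> {..<N}" "i < N" "i \<notin> D"
  shows "real (card {\<psi> \<in> colourings N m. \<exists>j\<in>D. \<psi> j = \<psi> i}) = real m ^ N * (1 - (1 - 1 / real m) ^ card D)"
proof -
  \<comment> \<open>A product set: \<open>i\<close> gets colour \<open>v\<close> and
    \<open>D\<close> avoids \<open>v\<close>. For different \<open>v\<close> these sets are
    disjoint, and together they form the collision-free colourings.\<close>
  define F where "F v j = (if j = i then {v} else if j \<in> D then {..<m} - {v} else {..<m})" for v j
  have "finite D" using assms(2) finite_subset by blast
  have card: "real (card (PiE {..<N} (F v))) = real m ^ N * (1 - 1 / real m) ^ card D / real m" if "v < m" for v
  proof -
    let ?x = "\<lambda>j. if j = i then 1 / real m else if j \<in> D then 1 - 1 / real m else 1"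
    have "real (card (PiE {..<N} (F v))) = (\<Prod>j<N. real m * ?x j)"
      using that assms(1) by (auto simp: card_PiE F_def of_nat_diff field_simps intro!: prod.cong)
    also have "\<dots> = real m ^ N * (\<Prod>j<N. ?x j)"
      by (simp only: prod.distrib prod_constant card_lessThan)
    also have "(\<Prod>j<N. ?x j) = (\<Prod>j\<in>insert i D. ?x j)"
      using assms by (intro prod.mono_neutral_right) auto
    also have "\<dots> = 1 / real m * (\<Prod>j\<in>D. ?x j)"
      using assms \<open>finite D\<close> by simp
    also have "(\<Prod>j\<in>D. ?x j) = (\<Prod>j\<in>D. 1 - 1 / real m)"
      using assms by (intro prod.cong) auto
    finally show ?thesis by simp
  qed
  have "{\<psi> \<in> colourings N m. \<forall>j\<in>D. \<psi> j \<noteq> \<psi> i} = (\<Union>v<m. PiE {..<N} (F v))"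
  proof (intro equalityI subsetI)
    fix \<psi> assume "\<psi> \<in> {\<psi> \<in> colourings N m. \<forall>j\<in>D. \<psi> j \<noteq> \<psi> i}"
    then show "\<psi> \<in> (\<Union>v<m. PiE {..<N} (F v))"
      using assms by (intro UN_I[of "\<psi> i"]) (auto simp: F_def PiE_def Pi_def)
  next
    fix \<psi> assume "\<psi> \<in> (\<Union>v<m. PiE {..<N} (F v))"
    then obtain v where v: "v < m" "\<psi> \<in> PiE {..<N} (F v)" by auto
    have "\<psi> j \<in> F v j" if "j < N" for j using v(2) that by auto
    moreover have "F v j \<subseteq> {..<m}" for j using v by (auto simp: F_def)
    moreover have "\<psi> i = v" using calculation(1)[OF assms(3)] by (simp add: F_def)
    moreover have "\<psi> j \<noteq> v" if "j \<in> D" for j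
      using calculation(1)[of j] assms that by (auto simp: F_def split: if_splits)
    ultimately show "\<psi> \<in> {\<psi> \<in> colourings N m. \<forall>j\<in>D. \<psi> j \<noteq> \<psi> i}"
      using v(2) by (auto simp: PiE_def Pi_def)
  qed
  moreover have "card (\<Union>v<m. PiE {..<N} (F v)) = (\<Sum>v<m. card (PiE {..<N} (F v)))"
  proof (rule card_UN_disjoint)
    show "\<forall>v\<in>{..<m}. finite (PiE {..<N} (F v))" by (auto simp: F_def intro!: finite_PiE)
    have "v = w" if "\<psi> \<in> PiE {..<N} (F v)" "\<psi> \<in> PiE {..<N} (F w)" for v w \<psi>
      using PiE_mem[OF that(1), of i] PiE_mem[OF that(2), of i] assms by (simp add: F_def)
    then show "\<forall>v\<in>{..<m}. \<forall>w\<in>{..<m}. v \<noteq> w \<longrightarrow> PiE {..<N} (F v) \<inter> PiE {..<N} (F w) = {}"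
      by blast
  qed simp
  ultimately have good: "real (card {\<psi> \<in> colourings N m. \<forall>j\<in>D. \<psi> j \<noteq> \<psi> i}) = real m ^ N * (1 - 1 / real m) ^ card D"
    using assms(1) by (simp add: card)
  define S where "S = {\<psi> \<in> colourings N m. \<forall>j\<in>D. \<psi> j \<noteq> \<psi> i}"
  have sub: "S \<subseteq> colourings N m" and fin: "finite (colourings N m)"
    by (auto simp: S_def intro: finite_PiE)
  have "{\<psi> \<in> colourings N m. \<exists>j\<in>D. \<psi> j = \<psi> i} = colourings N m - S"
    by (auto simp: S_def)
  moreover have "real (card (colourings N m - S)) = real (card (colourings N m)) - real (card S)"
    by (simp only: card_Diff_subset[OF finite_subset[OF sub fin] sub] of_nat_diff[OF card_mono[OF fin sub]])
  ultimately show ?thesis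
    by (simp add: good[folded S_def] card_PiE algebra_simps)
qed

text \<open>Averaging over independent uniformly random colourings: given the defective set \<open>D\<close>, the
  \<open>L\<close> rounds are independent, so a fixed non-defective item collides in all of them with
  probability exactly \<open>(1 - (1 - 1/m) ^ card D) ^ L\<close>.\<close>
lemma exists_colouring_few_collisions:
  assumes p: "0 \<le> p" "p \<le> 1" and m: "1 \<le> m"
  shows "\<exists>\<phi>. (\<forall>l<L. \<forall>i<N. \<phi> l i < m) \<and>
    bexp p {..<N} (\<lambda>D. real (card {i \<in> {..<N} - D. \<forall>l<L. \<exists>j\<in>D. \<phi> l j = \<phi> l i}))
      \<le> real N * bexp p {..<N} (\<lambda>D. (1 - (1 - 1 / real m) ^ card D) ^ L)"
proof -
  define \<Phi> where "\<Phi> = PiE {..<L} (\<lambda>_. colourings N m)"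
  let ?bad = "\<lambda>\<phi> D i. \<forall>l<L. \<exists>j\<in>D. \<phi> l j = \<phi> l i"
  let ?X = "\<lambda>\<phi> D. real (card {i \<in> {..<N} - D. ?bad \<phi> D i})"
  let ?Y = "\<lambda>D. (1 - (1 - 1 / real m) ^ card D) ^ L"
  have fin: "finite \<Phi>" by (auto simp: \<Phi>_def intro!: finite_PiE)
  have card: "real (card \<Phi>) = (real m ^ N) ^ L" by (simp add: \<Phi>_def card_PiE)
  then have ne: "\<Phi> \<noteq> {}" using m by (metis card.empty less_le_trans less_numeral_extra(1,3) of_nat_0_less_iff of_nat_0 zero_less_power)
  have Y: "(\<Sum>\<phi>\<in>\<Phi>. ?X \<phi> D) \<le> real (card \<Phi>) * (real N * ?Y D)" if D: "D \<subseteq> {..<N}" for D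
  proof -
    have 1: "(\<Sum>\<phi>\<in>\<Phi>. of_bool (?bad \<phi> D i)) = real (card \<Phi>) * ?Y D" if i: "i \<in> {..<N} - D" for i
    proof -
      have "(\<Sum>\<phi>\<in>\<Phi>. of_bool (?bad \<phi> D i)) = real (card {\<phi> \<in> \<Phi>. ?bad \<phi> D i})"
        using fin by (simp add: sum.If_cases of_bool_def Int_def)
      also have "{\<phi> \<in> \<Phi>. ?bad \<phi> D i} = PiE {..<L} (\<lambda>_. {\<psi> \<in> colourings N m. \<exists>j\<in>D. \<psi> j = \<psi> i})"
        unfolding \<Phi>_def PiE_def Pi_def by auto
      also have "real (card \<dots>) = real (card {\<psi> \<in> colourings N m. \<exists>j\<in>D. \<psi> j = \<psi> i}) ^ L"
        by (simp add: card_PiE)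
      also have "\<dots> = real (card \<Phi>) * ?Y D"
        using card_colliding_colourings[OF m D, of i] i card by (simp add: power_mult_distrib)
      finally show ?thesis .
    qed
    have "(\<Sum>\<phi>\<in>\<Phi>. ?X \<phi> D) = (\<Sum>\<phi>\<in>\<Phi>. \<Sum>i\<in>{..<N} - D. of_bool (?bad \<phi> D i))"
      by (simp add: sum.If_cases of_bool_def Int_def)
    also have "\<dots> = (\<Sum>i\<in>{..<N} - D. \<Sum>\<phi>\<in>\<Phi>. of_bool (?bad \<phi> D i))"
      by (rule sum.swap)
    also have "\<dots> = (\<Sum>i\<in>{..<N} - D. real (card \<Phi>) * ?Y D)"
      by (intro sum.cong refl 1)
    also have "\<dots> = real (card ({..<N} - D)) * (real (card \<Phi>) * ?Y D)" by simp
    also have "\<dots> \<le> real N * (real (card \<Phi>) * ?Y D)"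
    proof (rule mult_right_mono)
      show "real (card ({..<N} - D)) \<le> real N"
        using card_mono[of "{..<N}" "{..<N} - D"] by auto
      show "0 \<le> real (card \<Phi>) * ?Y D"
        using m by (intro mult_nonneg_nonneg zero_le_power) (auto intro!: power_le_one)
    qed
    finally show ?thesis by (simp add: mult_ac)
  qed
  \<comment> \<open>First-moment method: if every choice exceeded the bound, summing over the
    nonempty set \<open>\<Phi>\<close> would contradict \<open>Y\<close>.\<close>
  have "\<exists>\<phi>\<in>\<Phi>. bexp p {..<N} (?X \<phi>) \<le> real N * bexp p {..<N} ?Y"
  proof (rule ccontr)
    assume "\<not> ?thesis"
    then have "(\<Sum>\<phi>\<in>\<Phi>. real N * bexp p {..<N} ?Y) < (\<Sum>\<phi>\<in>\<Phi>. bexp p {..<N} (?X \<phi>))"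
      by (intro sum_strict_mono fin ne) auto
    also have "\<dots> = bexp p {..<N} (\<lambda>D. \<Sum>\<phi>\<in>\<Phi>. ?X \<phi> D)" by (simp add: bexp_sum)
    also have "\<dots> \<le> bexp p {..<N} (\<lambda>D. real (card \<Phi>) * (real N * ?Y D))"
      by (intro bexp_mono p Y)
    finally show False by (simp add: bexp_cmult)
  qed
  then obtain \<phi> where \<phi>: "\<phi> \<in> \<Phi>" "bexp p {..<N} (?X \<phi>) \<le> real N * bexp p {..<N} ?Y" by blast
  have "\<phi> l i < m" if "l < L" "i < N" for l i
    using \<phi>(1) that by (auto simp: \<Phi>_def PiE_def Pi_def)
  then show ?thesis using \<phi>(2) by blast
qed

text \<open>With at most \<open>N * p + t\<close> defectives a pool avoids them with probability at
  least 1/2, by \<open>- ln (1 - 1 / m) \<le> 1 / (m - 1)\<close>; hence the \<open>m - 1\<close> in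
  the hypothesis. Larger defective sets get the trivial bound 1 and are rare by Chebyshev.\<close>

lemma collision_probability_le:
  assumes p: "0 \<le> p" "p \<le> 1" and t: "0 < t" and m: "(real N * p + t) / ln 2 \<le> real m - 1"
  shows "bexp p {..<N} (\<lambda>D. (1 - (1 - 1 / real m) ^ card D) ^ L) \<le> (1/2) ^ L + real N * p / t\<^sup>2"
proof -
  have "0 < (real N * p + t) / ln 2" using p t by (simp add: add_nonneg_pos)
  then have m1: "1 < real m" using m by linarith
  have half: "1/2 \<le> (1 - 1 / real m) ^ k" if k: "real k \<le> real N * p + t" for k
  proof -
    have "ln (real m / (real m - 1)) \<le> real m / (real m - 1) - 1"
      using m1 by (intro ln_le_minus_one) simp
    also have "\<dots> = 1 / (real m - 1)" using m1 by (simp add: field_simps)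
    finally have ln: "- ln (1 - 1 / real m) \<le> 1 / (real m - 1)"
      using m1 by (simp add: ln_div diff_divide_distrib[symmetric] field_simps)
    have "real k * - ln (1 - 1 / real m) \<le> real k * (1 / (real m - 1))"
      by (intro mult_left_mono ln) auto
    also have "\<dots> \<le> (real N * p + t) / (real m - 1)"
      using k m1 by (simp add: divide_right_mono)
    also have "\<dots> \<le> ln 2" using m m1 by (simp add: field_simps)
    finally have "- ln 2 \<le> real k * ln (1 - 1 / real m)" by simp
    then have "exp (- ln 2) \<le> exp (real k * ln (1 - 1 / real m))" by simp
    also have "\<dots> = (1 - 1 / real m) ^ k"
      using m1 by (simp add: exp_of_nat_mult)
    finally show ?thesis by (simp add: exp_minus)
  qed
  have "bexp p {..<N} (\<lambda>D. (1 - (1 - 1 / real m) ^ card D) ^ L)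
      \<le> bexp p {..<N} (\<lambda>D. (1/2) ^ L + of_bool (real (card {..<N}) * p + t < real (card D)))"
  proof (intro bexp_mono p)
    fix D :: "nat set"
    let ?u = "1 - (1 - 1 / real m) ^ card D"
    have u: "0 \<le> ?u" "?u \<le> 1" using m1 by (auto intro!: power_le_one)
    show "?u ^ L \<le> (1/2) ^ L + of_bool (real (card {..<N}) * p + t < real (card D))"
    proof (cases "real N * p + t < real (card D)")
      case True
      have "?u ^ L \<le> 1" by (intro power_le_one u)
      also have "\<dots> \<le> (1/2) ^ L + 1" by simp
      finally show ?thesis using True by simp
    next
      case False
      then show ?thesis using half[of "card D"] u by (auto intro!: power_mono)
    qed
  qed
  also have "\<dots> \<le> (1/2) ^ L + real N * p / t\<^sup>2"
    using bexp_chebyshev[of p "{..<N}" t] p t by (simp add: bexp_add bexp_const)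
  finally show ?thesis .
qed

section \<open>Bounds for \<open>Tbar\<close> and their normalised forms\<close>

lemma card_U1_chi_le:
  assumes "finite D"
  shows "card (U1 N M c (chi D)) \<le> card D"
  using assms by (intro card_mono) (auto simp: U1_def chi_def split: if_splits)

text \<open>Individual testing by the identity matrix leaves nothing undecided.\<close>

lemma Tbar_le_trivial:
  assumes "1 \<le> N"
  shows "Tbar N p \<le> real N"
proof -
  define c where "c = restrict (\<lambda>(i, a). of_bool (i = a) :: nat) ({0..<N} \<times> {0..<N})"
  have c: "c (i, a) = of_bool (i = a)" if "i < N" "a < N" for i a
    using that by (simp add: c_def)
  have mat: "c \<in> matrices N N" by (auto simp: c_def matrices_def)
  have "Tcost N N c (chi D) = real N" for D
  proof -
    have "sure_zero N N c (chi D) i" if "i < N" "chi D i = 0" for i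
      unfolding sure_zero_def by (rule exI[of _ i]) (use that c in \<open>auto simp: test_outcome_def\<close>)
    then have "U0 N N c (chi D) = {}" by (auto simp: U0_def)
    moreover have "sure_one N N c (chi D) i" if "i < N" "chi D i = 1" for i
      unfolding sure_one_def by (intro conjI exI[of _ i]) (use that c in auto)
    then have "U1 N N c (chi D) = {}" by (auto simp: U1_def)
    ultimately show ?thesis by (simp add: Tcost_def)
  qed
  then have "Texp N N c p = real N" by (simp add: Texp_eq_bexp bexp_const)
  then show ?thesis using Tbar_le[OF assms le_refl mat, of p] by simp
qed

text \<open>The terms pay for tests, undetermined healthy items and defectives; the last bounds
  \<open>U1\<close>.\<close>

lemma Tbar_le_colouring:
  assumes p: "0 \<le> p" "p \<le> 1" and N: "1 \<le> N" and L: "1 \<le> L"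
    and t: "0 < t" and m: "(real N * p + t) / ln 2 \<le> real m - 1"
  shows "Tbar N p \<le> real L * real m + real N * ((1/2) ^ L + real N * p / t\<^sup>2) + real N * p"
\<comment> \<open>\<open>Tbar\<close> allows at most \<open>N\<close> tests. If the colouring design
  has more, individual testing is already cheaper.\<close>
proof (cases "L * m \<le> N")
  case False
  then have "real N \<le> real L * real m" by (metis less_imp_le not_le of_nat_le_iff of_nat_mult)
  moreover have "0 \<le> real N * ((1/2) ^ L + real N * p / t\<^sup>2) + real N * p" using p by simp
  ultimately show ?thesis using Tbar_le_trivial[OF N, of p] by linarith
next
  case True
  have "0 < (real N * p + t) / ln 2" using p t by (simp add: add_nonneg_pos)
  then have m1: "1 \<le> m" using m by (cases m) auto
  obtain \<phi> where \<phi>: "\<forall>l<L. \<forall>i<N. \<phi> l i < m"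
    and col: "bexp p {..<N} (\<lambda>D. real (card {i \<in> {..<N} - D. \<forall>l<L. \<exists>j\<in>D. \<phi> l j = \<phi> l i}))
      \<le> real N * bexp p {..<N} (\<lambda>D. (1 - (1 - 1 / real m) ^ card D) ^ L)"
    using exists_colouring_few_collisions[OF p m1, of L N] by blast
  let ?c = "colouring_design N L m \<phi>"
  let ?K = "\<lambda>D. {i \<in> {..<N} - D. \<forall>l<L. \<exists>j\<in>D. \<phi> l j = \<phi> l i}"
  have "Tbar N p \<le> Texp N (L * m) ?c p"
    using L m1 True by (intro Tbar_le colouring_design_in_matrices) (auto simp: Suc_le_eq)
  also have "\<dots> \<le> bexp p {..<N} (\<lambda>D. real (L * m) + real (card (?K D)) + real (card D))"
    unfolding Texp_eq_bexp
  proof (intro bexp_mono p)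
    fix D assume D: "D \<subseteq> {..<N}"
    have "card (U0 N (L * m) ?c (chi D)) \<le> card (?K D)"
      using U0_colouring_design[of L N \<phi> m D] \<phi> D by (intro card_mono) auto
    moreover have "card (U1 N (L * m) ?c (chi D)) \<le> card D"
      using D finite_subset by (intro card_U1_chi_le) auto
    ultimately show "Tcost N (L * m) ?c (chi D) \<le> real (L * m) + real (card (?K D)) + real (card D)"
      by (simp add: Tcost_def)
  qed
  also have "\<dots> = real L * real m + bexp p {..<N} (\<lambda>D. real (card (?K D))) + real N * p"
    by (simp add: bexp_add bexp_const bexp_card)
  also have "bexp p {..<N} (\<lambda>D. real (card (?K D))) \<le> real N * ((1/2) ^ L + real N * p / t\<^sup>2)"
    using col by (rule order_trans) (intro mult_left_mono collision_probability_le assms, simp)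
  finally show ?thesis by simp
qed

text \<open>The bound of \<open>Tbar_le_colouring\<close> over
  \<open>n * p * \<bar>ln p\<bar>\<close>, after \<open>L\<close>, \<open>m\<close> and
  \<open>(1/2) ^ L\<close> are replaced by upper estimates. The last term is the Chebyshev
  error.\<close>

definition upper_ratio :: "real \<Rightarrow> real \<Rightarrow> real" where
  "upper_ratio n p = (1 / ln 2 - 1 / ln p) * (2 / (n * p) + (1 - 1 / ln p) / ln 2) - 2 / ln p - ln p / (n * p\<^sup>2)"

text \<open>The bound of \<open>Tbar_ge\<close> over \<open>N * p * \<bar>ln p\<bar>\<close>; the
  factor \<open>N\<close> cancels.\<close>

definition lower_ratio :: "real \<Rightarrow> real" where
  "lower_ratio p = (let B = p / ((ln 2)\<^sup>2 - p * ln p) in B * (1 + ln ((1 - p) / B)) / (p * \<bar>ln p\<bar>))"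

lemma Tbar_ratio_le:
  assumes p: "0 < p" "p < 1" and N: "1 \<le> N"
  shows "Tbar N p / (real N * p * \<bar>ln p\<bar>) \<le> upper_ratio (real N) p"
proof -
  define l where "l = - ln p"
  have l: "0 < l" using p by (simp add: l_def)
  \<comment> \<open>About \<open>log2 (1/p)\<close> rounds make \<open>(1/2) ^ L \<le> p\<close>.
    The margin \<open>t\<close> is of smaller order than \<open>N * p\<close> as \<open>p\<close>
    tends to 0, so it does not affect the leading term of \<open>m\<close>; the \<open>+ 1\<close>
    serves the bound on \<open>m - 1\<close>.\<close>
  define L where "L = nat \<lceil>l / ln 2\<rceil>"
  define t where "t = real N * p / l"
  define m where "m = nat \<lceil>(real N * p + t) / ln 2\<rceil> + 1"
  have n: "0 < real N * p" using p N by simp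
  then have t: "0 < t" using l by (simp add: t_def)
  have pos: "0 < l / ln 2" "0 < (real N * p + t) / ln 2" using l n t by auto
  then have L: "l / ln 2 \<le> real L" "real L \<le> l / ln 2 + 1" "1 \<le> L"
    unfolding L_def by linarith+
  have m: "(real N * p + t) / ln 2 \<le> real m - 1" "real m \<le> (real N * p + t) / ln 2 + 2"
    using pos unfolding m_def by linarith+
  have "(1/2) ^ L = exp (- (real L * ln 2))"
    by (simp add: exp_minus exp_of_nat_mult power_divide inverse_eq_divide)
  also have "\<dots> \<le> exp (ln p)"
    using L(1) by (simp add: l_def field_simps)
  also have "\<dots> = p" using p by simp
  finally have half: "(1/2) ^ L \<le> p" .
  have "Tbar N p \<le> real L * real m + real N * ((1/2) ^ L + real N * p / t\<^sup>2) + real N * p"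
    using p N L t m by (intro Tbar_le_colouring) auto
  also have "\<dots> \<le> (l / ln 2 + 1) * ((real N * p + t) / ln 2 + 2) + real N * (p + real N * p / t\<^sup>2) + real N * p"
    using L m half pos p by (intro add_mono mult_mono order_refl) auto
  also have "\<dots> = upper_ratio (real N) p * (real N * p * l)"
  proof -
    have nz: "ln p = - l" "l \<noteq> 0" "p \<noteq> 0" "real N \<noteq> 0" using l p N by (auto simp: l_def)
    have 1: "1 / ln 2 - 1 / ln p = (l / ln 2 + 1) / l" using nz by (simp add: field_simps)
    have 2: "2 / (real N * p) + (1 - 1 / ln p) / ln 2 = ((real N * p + t) / ln 2 + 2) / (real N * p)"
      using nz by (simp add: t_def field_simps)
    have 3: "- 2 / ln p - ln p / (real N * p\<^sup>2) = (real N * (p + real N * p / t\<^sup>2) + real N * p) / (real N * p * l)"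
      using nz by (simp add: t_def field_simps power2_eq_square)
    have combine: "a / l * (b / n) + c / (n * l) = (a * b + c) / (n * l)" for a b c n :: real
      by (simp add: add_divide_distrib mult_ac)
    have "upper_ratio (real N) p = (l / ln 2 + 1) / l * (((real N * p + t) / ln 2 + 2) / (real N * p))
        + (real N * (p + real N * p / t\<^sup>2) + real N * p) / (real N * p * l)"
      unfolding upper_ratio_def 1[symmetric] 2[symmetric] 3[symmetric] by simp
    also have "\<dots> = ((l / ln 2 + 1) * ((real N * p + t) / ln 2 + 2) + (real N * (p + real N * p / t\<^sup>2) + real N * p)) / (real N * p * l)"
      by (rule combine)
    finally show ?thesis using nz by simp
  qed
  finally have "Tbar N p \<le> upper_ratio (real N) p * (real N * p * l)" .
  moreover have "\<bar>ln p\<bar> = l" using p by (simp add: l_def)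
  ultimately show ?thesis using l n by (simp add: pos_divide_le_eq)
qed

lemma Tbar_ratio_ge:
  assumes p: "0 < p" "p < 1" and N: "1 \<le> N"
  shows "lower_ratio p \<le> Tbar N p / (real N * p * \<bar>ln p\<bar>)"
proof -
  have "real N * (lower_ratio p * (p * \<bar>ln p\<bar>)) \<le> Tbar N p"
    using Tbar_ge[OF p N] p by (simp add: lower_ratio_def Let_def mult_ac)
  moreover have "0 < real N * p * \<bar>ln p\<bar>" using p N by (intro mult_pos_pos) auto
  ultimately show ?thesis by (simp only: pos_le_divide_eq mult_ac)
qed

text \<open>With \<open>B = p / K p\<close>, the logarithm splits as
  \<open>ln (1 - p) + ln (K p) - ln p\<close>; its last term dominates, and \<open>K p\<close> tends
  to \<open>(ln 2)\<^sup>2\<close>.\<close>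

lemma lower_ratio_tendsto: "(lower_ratio \<longlongrightarrow> 1 / (ln 2)\<^sup>2) (at_right 0)"
proof -
  define K where "K p = (ln 2)\<^sup>2 - p * ln p" for p :: real
  have K: "(K \<longlongrightarrow> (ln 2)\<^sup>2) (at_right 0)"
    unfolding K_def by real_asymp
  have "((\<lambda>p. 1 / K p * (1 - (1 + ln (1 - p) + ln (K p)) / ln p)) \<longlongrightarrow> 1 / (ln 2)\<^sup>2 * (1 - 0)) (at_right 0)"
  proof (intro tendsto_intros K)
    have "((\<lambda>p. 1 + ln (1 - p) + ln (K p)) \<longlongrightarrow> 1 + ln (1 - 0) + ln ((ln 2)\<^sup>2)) (at_right (0::real))"
      by (intro tendsto_intros K) auto
    moreover have "filterlim ln at_infinity (at_right (0::real))"
      using ln_at_0 filterlim_at_bot_imp_at_infinity by blast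
    ultimately show "((\<lambda>p. (1 + ln (1 - p) + ln (K p)) / ln p) \<longlongrightarrow> 0) (at_right 0)"
      by (rule tendsto_divide_0)
  qed auto
  moreover have "\<forall>\<^sub>F p in at_right 0. 1 / K p * (1 - (1 + ln (1 - p) + ln (K p)) / ln p) = lower_ratio p"
    using eventually_at_right_real[of 0 "1::real", OF zero_less_one]
  proof eventually_elim
    case (elim p)
    then have p: "0 < p" "p < 1" "ln p < 0" by auto
    then have "p * ln p \<le> 0" by (intro mult_nonneg_nonpos) auto
    moreover have "0 < (ln 2 :: real)\<^sup>2" by simp
    ultimately have K: "0 < K p" unfolding K_def by linarith
    have "ln ((1 - p) / (p / K p)) = ln (1 - p) + ln (K p) - ln p"
      using p K by (simp add: ln_div ln_mult)
    then show ?case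
      unfolding lower_ratio_def Let_def K_def[symmetric] using p K by (simp only:) (simp add: field_simps)
  qed
  ultimately have "(lower_ratio \<longlongrightarrow> 1 / (ln 2)\<^sup>2 * (1 - 0)) (at_right 0)"
    by (rule Lim_transform_eventually)
  then show ?thesis by simp
qed

subsection \<open>The limit\<close>

text \<open>Serves both regimes: \<open>y = 0\<close> when \<open>p\<close> tends to 0 along with
  \<open>N\<close>, and \<open>y = 1 / ln p\<close> when \<open>p\<close> is fixed.\<close>

lemma upper_ratio_tendsto:
  assumes "((\<lambda>x. 1 / ln (p x)) \<longlongrightarrow> y) F" "((\<lambda>x. 1 / (n x * p x)) \<longlongrightarrow> 0) F"
    and "((\<lambda>x. ln (p x) / (n x * (p x)\<^sup>2)) \<longlongrightarrow> 0) F"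
  shows "((\<lambda>x. upper_ratio (n x) (p x)) \<longlongrightarrow> (1 / ln 2 - y) * ((1 - y) / ln 2) - 2 * y) F"
proof -
  have "((\<lambda>x. (1 / ln 2 - 1 / ln (p x)) * (2 * (1 / (n x * p x)) + (1 - 1 / ln (p x)) / ln 2)
      - 2 * (1 / ln (p x)) - ln (p x) / (n x * (p x)\<^sup>2))
    \<longlongrightarrow> (1 / ln 2 - y) * (2 * 0 + (1 - y) / ln 2) - 2 * y - 0) F"
    by (intro tendsto_intros assms) auto
  then show ?thesis by (simp add: upper_ratio_def)
qed

lemma inverse_ln_tendsto_0: "((\<lambda>p::real. 1 / ln p) \<longlongrightarrow> 0) (at_right 0)"
  by real_asymp

lemma Tbar_nonneg:
  assumes "0 \<le> p" "p \<le> 1" "1 \<le> N"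
  shows "0 \<le> Tbar N p"
proof -
  obtain M c where "Tbar N p = Texp N M c p" using Tbar_attained[OF assms(3)] by metis
  then show ?thesis using assms by (simp add: Texp_eq_bexp bexp_nonneg Tcost_def)
qed

lemma Tbar_ratio_convergent:
  assumes "0 < p" "p < 1"
  shows "convergent (\<lambda>N. Tbar N p / (real N * p * \<bar>ln p\<bar>))"
proof -
  \<comment> \<open>\<open>Tbar 0 p\<close> is a minimum over the empty set, hence replaced by \<open>0\<close>.\<close>
  define b where "b N = (if N = 0 then 0 else Tbar N p)" for N
  have "convergent (\<lambda>N. b N / real N)"
  proof (rule fekete_convergent)
    show "b (m + n) \<le> b m + b n" for m n
      using Tbar_subadditive[of m n p] by (auto simp: b_def)
    show "0 \<le> b n" for n
      using Tbar_nonneg[of p n] assms by (auto simp: b_def)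
  qed
  then obtain L where "(\<lambda>N. b N / real N) \<longlonglongrightarrow> L" by (auto simp: convergent_def)
  then have "(\<lambda>N. b N / real N / (p * \<bar>ln p\<bar>)) \<longlonglongrightarrow> L / (p * \<bar>ln p\<bar>)"
    using assms by (intro tendsto_intros) auto
  moreover have "b N / real N / (p * \<bar>ln p\<bar>) = Tbar N p / (real N * p * \<bar>ln p\<bar>)" for N
    by (simp add: b_def)
  ultimately show ?thesis by (auto intro: convergentI)
qed

theorem theorem1:
  fixes \<beta> :: real
  assumes "0 \<le> \<beta>" and "\<beta> < 1/2"
  shows "lim_beta \<beta> (\<lambda>N p. Tbar N p / (real N * p * \<bar>ln p\<bar>)) (1 / (ln 2)^2)"
proof (cases "\<beta> > 0")
  case True
  define p where "p N = real N powr (- \<beta>)" for N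
  \<comment> \<open>At \<open>N = 1\<close> the value would be \<open>p = 1\<close>.\<close>
  have p: "0 < p N" "p N < 1" if "2 \<le> N" for N
    using that True by (auto simp: p_def powr_less_one)
  have p0: "filterlim p (at_right 0) sequentially"
    unfolding p_def using True by real_asymp
  have low: "(\<lambda>N. lower_ratio (p N)) \<longlonglongrightarrow> 1 / (ln 2)\<^sup>2"
    by (rule filterlim_compose[OF lower_ratio_tendsto p0])
  have "(\<lambda>N. upper_ratio (real N) (p N)) \<longlonglongrightarrow> (1 / ln 2 - 0) * ((1 - 0) / ln 2) - 2 * 0"
  proof (rule upper_ratio_tendsto)
    show "(\<lambda>N. 1 / ln (p N)) \<longlonglongrightarrow> 0"
      by (rule filterlim_compose[OF inverse_ln_tendsto_0 p0])
    \<comment> \<open>The exponent of \<open>N * p\<^sup>2\<close>, positive because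
      \<open>\<beta> < 1/2\<close>; this makes the Chebyshev error vanish.\<close>
    define d where "d = 1 - 2 * \<beta>"
    have d: "0 < d" using assms by (simp add: d_def)
    have np: "real N * p N = real N powr (1 - \<beta>)" "real N * (p N)\<^sup>2 = real N powr d"
      if "0 < N" for N
      using that by (auto simp: p_def d_def powr_add[symmetric] powr_diff powr_minus power2_eq_square field_simps)
    have lnp: "ln (p N) = - \<beta> * ln (real N)" for N
      by (simp add: p_def ln_powr)
    have "(\<lambda>N. 1 / real N powr (1 - \<beta>)) \<longlonglongrightarrow> 0"
      using assms by real_asymp
    then show "(\<lambda>N. 1 / (real N * p N)) \<longlonglongrightarrow> 0"
      by (rule Lim_transform_eventually)
        (rule eventually_mono[OF eventually_gt_at_top[of 0]], simp add: np(1))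
    have "(\<lambda>N. - \<beta> * ln (real N) / real N powr d) \<longlonglongrightarrow> 0"
      using d by real_asymp
    then show "(\<lambda>N. ln (p N) / (real N * (p N)\<^sup>2)) \<longlonglongrightarrow> 0"
      by (rule Lim_transform_eventually)
        (rule eventually_mono[OF eventually_gt_at_top[of 0]], simp add: np(2) lnp)
  qed
  then have upp: "(\<lambda>N. upper_ratio (real N) (p N)) \<longlonglongrightarrow> 1 / (ln 2)\<^sup>2"
    by (simp add: power2_eq_square)
  have "(\<lambda>N. Tbar N (p N) / (real N * p N * \<bar>ln (p N)\<bar>)) \<longlonglongrightarrow> 1 / (ln 2)\<^sup>2"
  proof (rule tendsto_sandwich[OF _ _ low upp])
    show "\<forall>\<^sub>F N in sequentially. lower_ratio (p N) \<le> Tbar N (p N) / (real N * p N * \<bar>ln (p N)\<bar>)"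
      using eventually_ge_at_top[of 2] by eventually_elim (rule Tbar_ratio_ge, use p in auto)
    show "\<forall>\<^sub>F N in sequentially. Tbar N (p N) / (real N * p N * \<bar>ln (p N)\<bar>) \<le> upper_ratio (real N) (p N)"
      using eventually_ge_at_top[of 2] by eventually_elim (rule Tbar_ratio_le, use p in auto)
  qed
  then show ?thesis using True by (simp add: lim_beta_def p_def)
next
  case False
  let ?f = "\<lambda>N p. Tbar N p / (real N * p * \<bar>ln p\<bar>)"
  let ?h = "\<lambda>p::real. (1 / ln 2 - 1 / ln p) * ((1 - 1 / ln p) / ln 2) - 2 * (1 / ln p)"
  define g where "g p = lim (\<lambda>N. ?f N p)" for p
  have g: "(\<lambda>N. ?f N p) \<longlonglongrightarrow> g p" if "0 < p" "p < 1" for p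
    using Tbar_ratio_convergent[OF that] by (simp add: g_def convergent_LIMSEQ_iff)
  have low: "lower_ratio p \<le> g p" if "0 < p" "p < 1" for p
    using g[OF that] Tbar_ratio_ge[OF that] by (intro LIMSEQ_le_const) auto
  \<comment> \<open>With \<open>p\<close> fixed, \<open>N\<close> goes to infinity first: the terms
    divided by \<open>N\<close> vanish, and the corrections in \<open>1 / ln p\<close> stay until
    \<open>p\<close> tends to 0.\<close>
  have upp: "g p \<le> ?h p" if p: "0 < p" "p < 1" for p
  proof (rule LIMSEQ_le[OF g[OF p]])
    show "(\<lambda>N. upper_ratio (real N) p) \<longlonglongrightarrow> ?h p"
    proof (rule upper_ratio_tendsto)
      show "(\<lambda>N. 1 / (real N * p)) \<longlonglongrightarrow> 0" using p by real_asymp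
      show "(\<lambda>N. ln p / (real N * p\<^sup>2)) \<longlonglongrightarrow> 0" using p by real_asymp
    qed simp
    show "\<exists>N. \<forall>n\<ge>N. ?f n p \<le> upper_ratio (real n) p"
      using Tbar_ratio_le[OF p] by blast
  qed
  have "(?h \<longlongrightarrow> (1 / ln 2 - 0) * ((1 - 0) / ln 2) - 2 * 0) (at_right 0)"
    by (intro tendsto_intros inverse_ln_tendsto_0) auto
  then have h: "(?h \<longlongrightarrow> 1 / (ln 2)\<^sup>2) (at_right 0)"
    by (simp add: power2_eq_square)
  have ev: "\<forall>\<^sub>F p in at_right 0. 0 < p \<and> p < (1::real)"
    using eventually_at_right_real[of 0 "1::real", OF zero_less_one] by eventually_elim auto
  have "(g \<longlongrightarrow> 1 / (ln 2)\<^sup>2) (at_right 0)"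
  proof (rule tendsto_sandwich[OF _ _ lower_ratio_tendsto h])
    show "\<forall>\<^sub>F p in at_right 0. lower_ratio p \<le> g p"
      using ev by eventually_elim (use low in auto)
    show "\<forall>\<^sub>F p in at_right 0. g p \<le> ?h p"
      using ev by eventually_elim (use upp in blast)
  qed
  moreover have "\<forall>\<^sub>F p in at_right 0. (\<lambda>N. ?f N p) \<longlonglongrightarrow> g p"
    using ev by eventually_elim (use g in blast)
  ultimately show ?thesis using False by (auto simp: lim_beta_def)
qed

end
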